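(* Let $n \geq 2$ be an integer and $\alpha = \frac{1}{2n+1}$. Let $X$ be an equiangular set with angle $\alpha$ and base size $K = K(X) = n+2$ in $\mathbb{R}^r$, and fix a $K$-base $P = \{p_1,\dots,p_K\}$ for $X$. If there is a $(K,1)$ pillar (with respect to $P$) with at least two vectors, then every other $(K,1)$ pillar $\bar{x}$ (with respect to $P$) satisfies $$|\bar{x}| \leq \begin{cases} 2n^2(n+1), & \text{if } n \leq 3,\\ \tfrac12 n^2 (n+1)^2, & \text{if } n \geq 3.\end{cases}$$
   Context: Equiangular set: a finite set $X=\{x_1,\dots,x_s\}$ of unit vectors in $\mathbb{R}^r$ is equiangular with angle $\alpha\in[0,1)$ if $\langle x_i,x_j\rangle\in\{-\alpha,\alpha\}$ for all $i\neq j$. Two sets of unit vectors are switching equivalent if one is obtained from the other by replacing some vectors by their negatives (and relabeling), i.e. they represent the same lines; correspondingly two Gram matrices satisfy $G\simeq G'$ if $G'=(CB)^{T}G(CB)$ with $B$ a diagonal $\pm1$ matrix and $C$ a permutation matrix. $I$ is the identity and $J$ the all-one matrix. Base size: $K(X)$ is the largest $k$ for which there are $p_1,\dots,p_k\in X$ whose Gram matrix satisfies $G(p_1,\dots,p_k)\simeq(1+\alpha)I-\alpha J$. A $K$-base of $X$ (with $K=K(X)$) is a set $P=\{p_1,\dots,p_K\}$ contained in some set switching equivalent to $X$ with $G(p_1,\dots,p_K)=(1+\alpha)I-\alpha J$ (so $\langle p_i,p_j\rangle=-\alpha$ for $i\ne j$). After switching one assumes $P\subset X$. Pillars with respect to $P$: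 for $x\in X\setminus P$ let $\varepsilon(x)\in\{1,-1\}^K$ be defined by $(\langle x,p_1\rangle,\dots,\langle x,p_K\rangle)=\alpha\,\varepsilon(x)$. Each $x\in X\setminus P$ is replaced by $-x$ if $\varepsilon(x)$ has more positive entries than $\varepsilon(-x)$, or if they have equally many positive entries and $\langle x,p_K\rangle=\alpha$; otherwise $x$ is kept. After this normalization, the pillar $\bar{x}$ of $x\in X\setminus P$ is the set of all $x'\in X\setminus P$ with $\varepsilon(x')=\varepsilon(x)$; it is called a $(K,m)$ pillar if $\varepsilon(x)$ has exactly $m$ positive entries. *)

theory Defs
  imports
    "HOL-Analysis.Analysis"
    "HOL-Combinatorics.Permutations"
    "Jordan_Normal_Form.Matrix"
begin

text \<open>
  Inner products are written with the constant \<open>inner\<close>, because the infix notation is also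
  claimed by the scalar product of the matrix library.
\<close>

definition equiangular :: "real \<Rightarrow> 'a::euclidean_space set \<Rightarrow> bool" where
  "equiangular \<alpha> X \<longleftrightarrow>
     0 \<le> \<alpha> \<and> \<alpha> < 1 \<and> finite X \<and> (\<forall>x\<in>X. norm x = 1) \<and>
     (\<forall>x\<in>X. \<forall>y\<in>X. x \<noteq> y \<longrightarrow> inner x y \<in> {-\<alpha>, \<alpha>})"

definition switching_equivalent :: "'a::euclidean_space set \<Rightarrow> 'a set \<Rightarrow> bool" where
  "switching_equivalent X Y \<longleftrightarrow> (\<exists>A\<subseteq>X. Y = (X - A) \<union> uminus ` A)"

definition gram :: "'a::euclidean_space list \<Rightarrow> real mat" where
  "gram ps = mat (length ps) (length ps) (\<lambda>(i, j). inner (ps ! i) (ps ! j))"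

definition sign_diagonal_mat :: "nat \<Rightarrow> real mat \<Rightarrow> bool" where
  "sign_diagonal_mat k B \<longleftrightarrow>
     B \<in> carrier_mat k k \<and> diagonal_mat B \<and> (\<forall>i<k. B $$ (i, i) \<in> {-1, 1})"

definition permutation_mat :: "nat \<Rightarrow> real mat \<Rightarrow> bool" where
  "permutation_mat k C \<longleftrightarrow>
     (\<exists>\<pi>. \<pi> permutes {..<k} \<and> C = mat k k (\<lambda>(i, j). if i = \<pi> j then 1 else 0))"

definition gram_equivalent :: "real mat \<Rightarrow> real mat \<Rightarrow> bool" where
  "gram_equivalent G G' \<longleftrightarrow>
     (\<exists>B C. sign_diagonal_mat (dim_row G) B \<and> permutation_mat (dim_row G) C \<and>
        G' = transpose_mat (C * B) * G * (C * B))"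

definition base_mat :: "real \<Rightarrow> nat \<Rightarrow> real mat" where
  "base_mat \<alpha> k = (1 + \<alpha>) \<cdot>\<^sub>m 1\<^sub>m k - \<alpha> \<cdot>\<^sub>m mat k k (\<lambda>_. 1)"

text \<open>
  For \<open>\<alpha> < 1\<close> the matrix condition forces the entries of \<open>ps\<close> to be distinct, so if \<open>X\<close> is finite
  the maximum is taken over a finite set; it contains \<open>0\<close>.
\<close>
definition base_size :: "real \<Rightarrow> 'a::euclidean_space set \<Rightarrow> nat" where
  "base_size \<alpha> X =
     Max {k. \<exists>ps. length ps = k \<and> set ps \<subseteq> X \<and> gram_equivalent (gram ps) (base_mat \<alpha> k)}"

text \<open>A base is a list, since the normalization below singles out its last vector.\<close>
definition K_base :: "real \<Rightarrow> 'a::euclidean_space set \<Rightarrow> 'a list \<Rightarrow> bool" where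
  "K_base \<alpha> X ps \<longleftrightarrow>
     length ps = base_size \<alpha> X \<and>
     (\<exists>Y. switching_equivalent X Y \<and> set ps \<subseteq> Y) \<and>
     gram ps = base_mat \<alpha> (length ps)"

text \<open>
  For \<open>\<alpha> \<noteq> 0\<close> this is the unique \<open>\<epsilon>\<close> with \<open>(\<langle>x, p\<^sub>1\<rangle>, \<dots>, \<langle>x, p\<^sub>K\<rangle>) = \<alpha> \<epsilon>\<close>.
\<close>
definition sign_vec :: "real \<Rightarrow> 'a::euclidean_space list \<Rightarrow> 'a \<Rightarrow> real list" where
  "sign_vec \<alpha> ps x = map (\<lambda>p. inner x p / \<alpha>) ps"

definition num_pos :: "real list \<Rightarrow> nat" where
  "num_pos e = length (filter (\<lambda>t. 0 < t) e)"

definition normalize_sign :: "real \<Rightarrow> 'a::euclidean_space list \<Rightarrow> 'a \<Rightarrow> 'a" where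
  "normalize_sign \<alpha> ps x =
     (if num_pos (sign_vec \<alpha> ps x) > num_pos (sign_vec \<alpha> ps (- x)) \<or>
         (num_pos (sign_vec \<alpha> ps x) = num_pos (sign_vec \<alpha> ps (- x)) \<and> inner x (last ps) = \<alpha>)
      then - x else x)"

definition normalized_rest :: "real \<Rightarrow> 'a::euclidean_space set \<Rightarrow> 'a list \<Rightarrow> 'a set" where
  "normalized_rest \<alpha> X ps = normalize_sign \<alpha> ps ` (X - set ps)"

definition pillar :: "real \<Rightarrow> 'a::euclidean_space set \<Rightarrow> 'a list \<Rightarrow> 'a \<Rightarrow> 'a set" where
  "pillar \<alpha> X ps x = {x' \<in> normalized_rest \<alpha> X ps. sign_vec \<alpha> ps x' = sign_vec \<alpha> ps x}"

text \<open>
  The \<open>(K, m)\<close> pillars of \<open>X\<close> with respect to \<open>ps \<subseteq> X\<close>, where \<open>K\<close> is the length of \<open>ps\<close>.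
\<close>
definition is_pillar :: "real \<Rightarrow> 'a::euclidean_space set \<Rightarrow> 'a list \<Rightarrow> nat \<Rightarrow> 'a set \<Rightarrow> bool" where
  "is_pillar \<alpha> X ps m Q \<longleftrightarrow>
     (\<exists>x\<in>normalized_rest \<alpha> X ps. num_pos (sign_vec \<alpha> ps x) = m \<and> Q = pillar \<alpha> X ps x)"

end

theory Submission
  imports Defs
begin

text \<open>
  A vector of a \<open>(K, 1)\<close> pillar has inner product \<open>-\<alpha>\<close> with all base vectors but one, say with
  those of \<open>P - {p}\<close>. If two vectors of the pillar had inner product \<open>-\<alpha>\<close>, then together with
  \<open>P - {p}\<close> they would be \<open>K + 1\<close> vectors with all inner products \<open>-\<alpha>\<close>, contrary to the definition
  of the base size (\<open>clique_card_le_base_size\<close>). So inside a \<open>(K, 1)\<close> pillar all inner products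
  are \<open>+\<alpha>\<close>.

  Now remove from every pillar vector its orthogonal projection onto the span of \<open>P\<close>. For
  \<open>\<alpha> = 1/(2n+1)\<close> and \<open>K = n + 2\<close> this lowers an inner product by exactly \<open>\<alpha>\<close> inside one pillar
  and by \<open>\<alpha>(n-1)/(n+1)\<close> between two of them (\<open>inner_residuals\<close>). Hence the residuals of one pillar
  are pairwise orthogonal of squared length \<open>c = 1 - \<alpha>\<close>, while residuals from two different pillars
  have inner product \<open>d\<close> or \<open>-n d\<close>, where \<open>d = 2\<alpha>/(n+1)\<close> and \<open>c = n(n+1) d\<close>.

  Two vectors \<open>u, v\<close> of the first pillar are thus tested against an orthogonal system indexed by the
  second one. Bessel's inequality for \<open>u + v\<close>, and for small \<open>n\<close> a combination of it with the one
  for \<open>u - v\<close>, bounds the size of the system (\<open>orthogonal_system_card_bound\<close>).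
\<close>

section \<open>Orthogonal systems\<close>

text \<open>
  Bessel's inequality for a system whose members have the common squared length \<open>c\<close>; keeping \<open>c\<close>
  avoids normalizing by a square root.
\<close>
lemma bessel_orthogonal:
  fixes f :: "'b \<Rightarrow> 'a::real_inner"
  assumes "finite S" and "c > 0"
    and orth: "\<And>x y. x \<in> S \<Longrightarrow> y \<in> S \<Longrightarrow> inner (f x) (f y) = (if x = y then c else 0)"
  shows "(\<Sum>x\<in>S. (inner w (f x))\<^sup>2) \<le> c * inner w w"
proof -
  define s where "s = (\<Sum>x\<in>S. inner w (f x) *\<^sub>R f x)"
  let ?B = "\<Sum>x\<in>S. (inner w (f x))\<^sup>2"
  have ws: "inner w s = ?B"
    by (simp add: s_def inner_sum_right power2_eq_square)
  have fs: "inner (f x) s = c * inner w (f x)" if "x \<in> S" for x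
  proof -
    have "inner (f x) s = (\<Sum>y\<in>S. inner w (f y) * (if x = y then c else 0))"
      unfolding s_def inner_sum_right using orth that by (intro sum.cong) auto
    also have "\<dots> = (\<Sum>y\<in>S. if x = y then inner w (f y) * c else 0)"
      by (intro sum.cong) auto
    finally show ?thesis using assms(1) that by simp
  qed
  have "inner s s = (\<Sum>x\<in>S. inner w (f x) * inner (f x) s)"
    by (subst (1) s_def) (simp add: inner_sum_left)
  also have "\<dots> = c * ?B"
    by (simp add: fs sum_distrib_left power2_eq_square algebra_simps)
  finally have ss: "inner s s = c * ?B" .
  have "0 \<le> inner (c *\<^sub>R w - s) (c *\<^sub>R w - s)" by simp
  also have "\<dots> = c * (c * inner w w - ?B)"
    using ws ss by (simp add: inner_diff_left inner_diff_right inner_commute[of s w] algebra_simps)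
  finally show ?thesis using assms(2) by (simp add: zero_le_mult_iff)
qed

text \<open>
  Divide all inner products by \<open>d\<close>, and let \<open>a, b \<in> {1, -n}\<close> be the values for \<open>u\<close> and \<open>v\<close> at an
  index \<open>x\<close>. Bessel's inequality bounds both \<open>\<Sum>(a + b)\<^sup>2\<close> and \<open>\<Sum>(a - b)\<^sup>2\<close> by \<open>2n\<^sup>2(n+1)\<^sup>2\<close>.
  The possible values of \<open>(a + b)\<^sup>2\<close> are \<open>4\<close>, \<open>(n-1)\<^sup>2\<close> and \<open>4n\<^sup>2\<close>. For \<open>n \<ge> 3\<close> all of them are at
  least \<open>4\<close>, and the first bound suffices. For \<open>n \<le> 3\<close> the mixed indices contribute only
  \<open>(n-1)\<^sup>2 \<le> 4\<close>; since they are exactly those with \<open>a - b \<noteq> 0\<close>, the second bound makes up for the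
  deficit.
\<close>
lemma orthogonal_system_card_bound:
  fixes f :: "'b \<Rightarrow> 'a::real_inner" and n :: nat
  assumes "finite S" and "n \<ge> 1" and "d > 0" and c: "c = real n * (real n + 1) * d"
    and orth: "\<And>x y. x \<in> S \<Longrightarrow> y \<in> S \<Longrightarrow> inner (f x) (f y) = (if x = y then c else 0)"
    and uv: "inner u u = c" "inner v v = c" "inner u v = 0"
    and u: "\<And>x. x \<in> S \<Longrightarrow> inner u (f x) \<in> {d, - real n * d}"
    and v: "\<And>x. x \<in> S \<Longrightarrow> inner v (f x) \<in> {d, - real n * d}"
  shows "n \<le> 3 \<Longrightarrow> real (card S) \<le> 2 * real n ^ 2 * (real n + 1)"
    and "n \<ge> 3 \<Longrightarrow> real (card S) \<le> 1 / 2 * real n ^ 2 * (real n + 1) ^ 2"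
proof -
  define N where "N = real n"
  have "c > 0" using assms(2,3) by (simp add: c)
  define A where "A = (\<Sum>x\<in>S. (inner (u + v) (f x) / d)\<^sup>2)"
  define B where "B = (\<Sum>x\<in>S. (inner (u - v) (f x) / d)\<^sup>2)"
  have bound: "(\<Sum>x\<in>S. (inner w (f x) / d)\<^sup>2) \<le> 2 * N\<^sup>2 * (N + 1)\<^sup>2"
    if "inner w w = 2 * c" for w
  proof -
    have "(\<Sum>x\<in>S. (inner w (f x))\<^sup>2) \<le> c * (2 * c)"
      using bessel_orthogonal[OF assms(1) \<open>c > 0\<close> orth, of w] that by simp
    then have "(\<Sum>x\<in>S. (inner w (f x))\<^sup>2) / d\<^sup>2 \<le> c * (2 * c) / d\<^sup>2"
      by (rule divide_right_mono) simp
    also have "c * (2 * c) / d\<^sup>2 = 2 * N\<^sup>2 * (N + 1)\<^sup>2"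
      using \<open>d > 0\<close> by (simp add: c N_def power2_eq_square)
    finally show ?thesis by (simp add: power_divide sum_divide_distrib)
  qed
  have A: "A \<le> 2 * N\<^sup>2 * (N + 1)\<^sup>2"
    unfolding A_def using uv
    by (intro bound) (simp add: inner_add_left inner_add_right inner_commute[of v u])
  have B: "B \<le> 2 * N\<^sup>2 * (N + 1)\<^sup>2"
    unfolding B_def using uv
    by (intro bound) (simp add: inner_diff_left inner_diff_right inner_commute[of v u])
  have signs: "inner u (f x) / d \<in> {1, - N}" "inner v (f x) / d \<in> {1, - N}" if "x \<in> S" for x
    using u[OF that] v[OF that] \<open>d > 0\<close> by (auto simp: N_def)
  have plus: "inner (u + v) z / d = inner u z / d + inner v z / d"
    and minus: "inner (u - v) z / d = inner u z / d - inner v z / d" for z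
    by (simp_all add: inner_add_left inner_diff_left add_divide_distrib diff_divide_distrib)
  have N1: "N\<^sup>2 \<ge> 1" using assms(2) by (simp add: N_def)
  show "real (card S) \<le> 2 * real n ^ 2 * (real n + 1)" if "n \<le> 3"
  proof -
    \<comment> \<open>Chosen such that a mixed index contributes \<open>(N - 1)\<^sup>2 + \<mu> (N + 1)\<^sup>2 = 4\<close>.\<close>
    define \<mu> where "\<mu> = (4 - (N - 1)\<^sup>2) / (N + 1)\<^sup>2"
    have Npos: "(N + 1)\<^sup>2 > 0" using assms(2) by (simp add: N_def)
    have lam: "\<mu> * (N + 1)\<^sup>2 = 4 - (N - 1)\<^sup>2" using Npos by (simp add: \<mu>_def)
    have "(N - 1)\<^sup>2 \<le> 2\<^sup>2"
      using that assms(2) by (intro power_mono) (auto simp: N_def)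
    then have "\<mu> \<ge> 0" by (simp add: \<mu>_def)
    have "4 \<le> (a + b)\<^sup>2 + \<mu> * (a - b)\<^sup>2" if "a \<in> {1, - N}" "b \<in> {1, - N}" for a b
      using that lam N1 by (auto simp: power2_eq_square algebra_simps)
    then have "4 \<le> (inner (u + v) (f x) / d)\<^sup>2 + \<mu> * (inner (u - v) (f x) / d)\<^sup>2"
      if "x \<in> S" for x
      using signs[OF that] unfolding plus minus by blast
    then have "(\<Sum>x\<in>S. 4) \<le> A + \<mu> * B"
      unfolding A_def B_def sum_distrib_left sum.distrib[symmetric] by (intro sum_mono)
    also have "\<dots> \<le> 2 * N\<^sup>2 * (N + 1)\<^sup>2 + \<mu> * (2 * N\<^sup>2 * (N + 1)\<^sup>2)"
      using A B \<open>\<mu> \<ge> 0\<close> by (intro add_mono mult_left_mono)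
    also have "\<mu> * (2 * N\<^sup>2 * (N + 1)\<^sup>2) = 2 * N\<^sup>2 * (4 - (N - 1)\<^sup>2)"
      using lam by (metis mult.assoc mult.commute)
    also have "2 * N\<^sup>2 * (N + 1)\<^sup>2 + 2 * N\<^sup>2 * (4 - (N - 1)\<^sup>2) = 4 * (2 * N\<^sup>2 * (N + 1))"
      by (simp add: power2_eq_square algebra_simps)
    finally show ?thesis by (simp add: N_def mult_ac)
  qed
  show "real (card S) \<le> 1 / 2 * real n ^ 2 * (real n + 1) ^ 2" if "n \<ge> 3"
  proof -
    have "2\<^sup>2 \<le> (N - 1)\<^sup>2"
      using that by (intro power_mono) (auto simp: N_def)
    then have "4 \<le> (a + b)\<^sup>2" if "a \<in> {1, - N}" "b \<in> {1, - N}" for a b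
      using that N1 by (auto simp: power2_eq_square algebra_simps)
    then have "4 \<le> (inner (u + v) (f x) / d)\<^sup>2" if "x \<in> S" for x
      using signs[OF that] unfolding plus by blast
    then have "(\<Sum>x\<in>S. 4) \<le> A"
      unfolding A_def by (intro sum_mono)
    with A show ?thesis by (simp add: N_def)
  qed
qed

section \<open>Cliques and the base size\<close>

lemma mult_mat_entry:
  assumes "A \<in> carrier_mat k k" "B \<in> carrier_mat k k" "i < k" "j < k"
  shows "(A * B) $$ (i, j) = (\<Sum>l\<in>{0..<k}. A $$ (i, l) * B $$ (l, j))"
  using assms by (simp add: scalar_prod_def)

lemma signed_permutation_congruence_entry:
  assumes B: "sign_diagonal_mat k B" and \<pi>: "\<pi> permutes {..<k}"
    and C: "C = mat k k (\<lambda>(i, j). if i = \<pi> j then 1 else 0)"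
    and G: "G \<in> carrier_mat k k" and ij: "i < k" "j < k"
  shows "(transpose_mat (C * B) * G * (C * B)) $$ (i, j)
      = B $$ (i, i) * G $$ (\<pi> i, \<pi> j) * B $$ (j, j)"
proof -
  have cB: "B \<in> carrier_mat k k" and dB: "\<And>a b. a < k \<Longrightarrow> b < k \<Longrightarrow> a \<noteq> b \<Longrightarrow> B $$ (a, b) = 0"
    using B by (auto simp: sign_diagonal_mat_def diagonal_mat_def)
  have cC: "C \<in> carrier_mat k k" by (simp add: C)
  have \<pi>k: "\<pi> a < k" if "a < k" for a
    using permutes_in_image[OF \<pi>, of a] that by simp
  define M where "M = C * B"
  have M_entry: "M $$ (a, b) = (if a = \<pi> b then B $$ (b, b) else 0)" if "a < k" "b < k" for a b
  proof -
    have "M $$ (a, b) = (\<Sum>l\<in>{0..<k}. C $$ (a, l) * B $$ (l, b))"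
      unfolding M_def using that by (rule mult_mat_entry[OF cC cB])
    also have "\<dots> = (\<Sum>l\<in>{0..<k}. if l = b then C $$ (a, b) * B $$ (b, b) else 0)"
      using that dB by (intro sum.cong) auto
    finally show ?thesis using that by (simp add: C)
  qed
  have cM: "M \<in> carrier_mat k k" using cB cC by (simp add: M_def)
  have TG: "(transpose_mat M * G) $$ (a, b) = B $$ (a, a) * G $$ (\<pi> a, b)"
    if "a < k" "b < k" for a b
  proof -
    have "(transpose_mat M * G) $$ (a, b) = (\<Sum>l\<in>{0..<k}. M $$ (l, a) * G $$ (l, b))"
      using mult_mat_entry[of "transpose_mat M" k G a b] that cM G by simp
    also have "\<dots> = (\<Sum>l\<in>{0..<k}. if l = \<pi> a then B $$ (a, a) * G $$ (\<pi> a, b) else 0)"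
      using that by (intro sum.cong) (auto simp: M_entry)
    finally show ?thesis using \<pi>k that by simp
  qed
  have cTG: "transpose_mat M * G \<in> carrier_mat k k" using cM G by simp
  have "(transpose_mat M * G * M) $$ (i, j)
      = (\<Sum>l\<in>{0..<k}. (transpose_mat M * G) $$ (i, l) * M $$ (l, j))"
    using ij by (rule mult_mat_entry[OF cTG cM])
  also have "\<dots> = (\<Sum>l\<in>{0..<k}. if l = \<pi> j then B $$ (i, i) * G $$ (\<pi> i, \<pi> j) * B $$ (j, j) else 0)"
    using ij by (intro sum.cong) (auto simp: M_entry TG)
  finally show ?thesis using \<pi>k ij by (simp add: M_def)
qed

lemma base_mat_entry:
  assumes "i < k" "j < k"
  shows "base_mat \<alpha> k $$ (i, j) = (if i = j then 1 else - \<alpha>)"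
  using assms by (simp add: base_mat_def)

text \<open>
  The entries of an equivalent Gram matrix agree up to sign, so an off-diagonal one has modulus
  \<open>\<alpha> < 1\<close>, whereas two equal unit vectors have inner product \<open>1\<close>.
\<close>
lemma distinct_if_gram_equivalent_base_mat:
  assumes X: "equiangular \<alpha> X" and "set ps \<subseteq> X"
    and eq: "gram_equivalent (gram ps) (base_mat \<alpha> (length ps))"
  shows "distinct ps"
  unfolding distinct_conv_nth
proof (intro allI impI)
  fix i j assume i: "i < length ps" and j: "j < length ps" and ne: "i \<noteq> j"
  let ?k = "length ps"
  obtain B \<pi> C where B: "sign_diagonal_mat ?k B" and \<pi>: "\<pi> permutes {..<?k}"
    and C: "C = mat ?k ?k (\<lambda>(i, j). if i = \<pi> j then 1 else 0)"
    and G: "base_mat \<alpha> ?k = transpose_mat (C * B) * gram ps * (C * B)"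
    using eq by (auto simp: gram_equivalent_def permutation_mat_def gram_def)
  obtain i' j' where i': "i' < ?k" "\<pi> i' = i" and j': "j' < ?k" "\<pi> j' = j"
    using permutes_image[OF \<pi>] i j by (metis imageE lessThan_iff)
  have "- \<alpha> = B $$ (i', i') * gram ps $$ (i, j) * B $$ (j', j')"
    using signed_permutation_congruence_entry[OF B \<pi> C _ i'(1) j'(1), of "gram ps"]
      G base_mat_entry[OF i'(1) j'(1), of \<alpha>] i' j' ne by (auto simp: gram_def)
  moreover have "B $$ (i', i') \<in> {-1, 1}" "B $$ (j', j') \<in> {-1, 1}"
    using B i' j' by (auto simp: sign_diagonal_mat_def)
  ultimately have "\<bar>inner (ps ! i) (ps ! j)\<bar> = \<bar>\<alpha>\<bar>"
    using i j by (auto simp: gram_def)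
  moreover have "\<bar>\<alpha>\<bar> < 1" using X by (simp add: equiangular_def)
  moreover have "norm (ps ! i) = 1"
    using X nth_mem[OF i] assms(2) unfolding equiangular_def by blast
  then have "inner (ps ! i) (ps ! i) = 1" by (simp add: norm_eq_1)
  ultimately show "ps ! i \<noteq> ps ! j" by auto
qed

text \<open>
  The vectors of the clique need only represent lines of \<open>X\<close>: their signs become the diagonal matrix
  of the equivalence. The maximum that defines the base size is attained because every list
  that it ranges over consists of distinct elements of the finite set \<open>X\<close>.
\<close>
lemma clique_card_le_base_size:
  assumes X: "equiangular \<alpha> X" and "finite W"
    and W: "\<And>w. w \<in> W \<Longrightarrow> w \<in> X \<or> - w \<in> X"
    and clique: "\<And>w z. w \<in> W \<Longrightarrow> z \<in> W \<Longrightarrow> w \<noteq> z \<Longrightarrow> inner w z = - \<alpha>"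
  shows "card W \<le> base_size \<alpha> X"
proof -
  define \<K> where
    "\<K> = {k. \<exists>ps. length ps = k \<and> set ps \<subseteq> X \<and> gram_equivalent (gram ps) (base_mat \<alpha> k)}"
  have "finite X" using X by (simp add: equiangular_def)
  have "\<K> \<subseteq> {..card X}"
  proof
    fix k assume "k \<in> \<K>"
    then obtain ps where ps: "length ps = k" "set ps \<subseteq> X" "gram_equivalent (gram ps) (base_mat \<alpha> k)"
      by (auto simp: \<K>_def)
    then have "card (set ps) = k"
      using distinct_if_gram_equivalent_base_mat[OF X] distinct_card by metis
    then show "k \<in> {..card X}" using card_mono[OF \<open>finite X\<close> ps(2)] by simp
  qed
  then have fin: "finite \<K>" by (rule finite_subset) simp
  obtain ws where ws: "set ws = W" "distinct ws"
    using finite_distinct_list[OF assms(2)] by blast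
  define k where "k = length ws"
  define s :: "'a \<Rightarrow> real" where "s w = (if w \<in> X then 1 else - 1)" for w
  define qs where "qs = map (\<lambda>w. s w *\<^sub>R w) ws"
  have len: "length qs = k" by (simp add: qs_def k_def)
  have "s w *\<^sub>R w \<in> X" if "w \<in> W" for w using W[OF that] by (auto simp: s_def)
  then have qs: "set qs \<subseteq> X" using ws by (auto simp: qs_def)
  define B where "B = mat k k (\<lambda>(i, j). if i = j then s (ws ! i) else 0)"
  define C :: "real mat" where "C = mat k k (\<lambda>(i, j). if i = id j then 1 else 0)"
  have B: "sign_diagonal_mat k B"
    by (auto simp: sign_diagonal_mat_def diagonal_mat_def B_def s_def)
  have perm: "id permutes {..<k}" by (rule permutes_id)
  have cG: "gram qs \<in> carrier_mat k k" by (simp add: gram_def len)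
  have "base_mat \<alpha> k = transpose_mat (C * B) * gram qs * (C * B)"
  proof (rule eq_matI)
    fix i j
    assume "i < dim_row (transpose_mat (C * B) * gram qs * (C * B))"
      and "j < dim_col (transpose_mat (C * B) * gram qs * (C * B))"
    then have ij: "i < k" "j < k" by (simp_all add: B_def)
    have unit: "inner (ws ! i) (ws ! i) = 1"
    proof -
      have "ws ! i \<in> W" using ws ij by (auto simp: k_def)
      then have "norm (ws ! i) = 1"
        using W X unfolding equiangular_def by (metis norm_minus_cancel)
      then show ?thesis by (simp add: norm_eq_1)
    qed
    have off: "inner (ws ! i) (ws ! j) = - \<alpha>" if "i \<noteq> j"
      using ws ij that by (intro clique) (auto simp: k_def nth_eq_iff_index_eq)
    have "(transpose_mat (C * B) * gram qs * (C * B)) $$ (i, j)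
        = B $$ (i, i) * gram qs $$ (i, j) * B $$ (j, j)"
      using signed_permutation_congruence_entry[OF B perm C_def cG ij] by simp
    also have "\<dots> = s (ws ! i) * (s (ws ! i) * s (ws ! j) * inner (ws ! i) (ws ! j)) * s (ws ! j)"
      using ij by (simp add: B_def gram_def qs_def k_def)
    also have "\<dots> = inner (ws ! i) (ws ! j)"
      by (simp add: s_def)
    finally show "base_mat \<alpha> k $$ (i, j) = (transpose_mat (C * B) * gram qs * (C * B)) $$ (i, j)"
      using unit off ij by (cases "i = j") (simp_all add: base_mat_entry)
  qed (simp_all add: base_mat_def B_def)
  moreover have "permutation_mat k C"
    using perm C_def unfolding permutation_mat_def by blast
  ultimately have "gram_equivalent (gram qs) (base_mat \<alpha> k)"
    using B cG unfolding gram_equivalent_def by auto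
  then have "k \<in> \<K>" using qs len by (auto simp: \<K>_def)
  then have "k \<le> Max \<K>" using fin by simp
  moreover have "card W = k" using ws distinct_card by (auto simp: k_def)
  ultimately show ?thesis by (simp add: base_size_def \<K>_def)
qed

lemma gram_base_mat_distinct:
  assumes "gram ps = base_mat \<alpha> (length ps)" and "\<alpha> \<noteq> - 1"
  shows "distinct ps"
    and "\<And>p q. p \<in> set ps \<Longrightarrow> q \<in> set ps \<Longrightarrow> inner p q = (if p = q then 1 else - \<alpha>)"
proof -
  have entry: "inner (ps ! i) (ps ! j) = (if i = j then 1 else - \<alpha>)"
    if "i < length ps" "j < length ps" for i j
    using arg_cong[OF assms(1), of "\<lambda>M. M $$ (i, j)"] base_mat_entry[OF that, of \<alpha>] that
    by (simp add: gram_def)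
  show "distinct ps"
    unfolding distinct_conv_nth
  proof (intro allI impI notI)
    fix i j assume ij: "i < length ps" "j < length ps" "i \<noteq> j" "ps ! i = ps ! j"
    then show False using entry[of i j] entry[of i i] assms(2) by simp
  qed
  then show "inner p q = (if p = q then 1 else - \<alpha>)" if "p \<in> set ps" "q \<in> set ps" for p q
    using that entry by (auto simp: in_set_conv_nth nth_eq_iff_index_eq)
qed

section \<open>Pillars with one positive sign\<close>

text \<open>
  The point is that \<open>X'\<close> never contains both \<open>x\<close> and \<open>-x\<close>: distinct members of \<open>X'\<close> come from
  distinct members of \<open>X\<close>.
\<close>
lemma switching_equivalent_equiangular:
  assumes X: "equiangular \<alpha> X" and sw: "switching_equivalent X X'"
  shows "equiangular \<alpha> X'" and "\<And>x. x \<in> X' \<Longrightarrow> x \<in> X \<or> - x \<in> X"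
proof -
  obtain A where A: "A \<subseteq> X" "X' = (X - A) \<union> uminus ` A"
    using sw by (auto simp: switching_equivalent_def)
  show "\<And>x. x \<in> X' \<Longrightarrow> x \<in> X \<or> - x \<in> X" using A by auto
  have XD: "0 \<le> \<alpha>" "\<alpha> < 1" "finite X" "\<And>x. x \<in> X \<Longrightarrow> norm x = 1"
    "\<And>x y. x \<in> X \<Longrightarrow> y \<in> X \<Longrightarrow> x \<noteq> y \<Longrightarrow> inner x y \<in> {-\<alpha>, \<alpha>}"
    using X unfolding equiangular_def by auto
  have origin: "\<exists>a\<in>X. (x = a \<and> a \<notin> A) \<or> (x = - a \<and> a \<in> A)" if x: "x \<in> X'" for x
  proof -
    consider "x \<in> X" "x \<notin> A" | a where "a \<in> A" "x = - a" using x A(2) by blast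
    then show ?thesis using A(1) by cases auto
  qed
  have "inner x y \<in> {-\<alpha>, \<alpha>}" if xy: "x \<in> X'" "y \<in> X'" "x \<noteq> y" for x y
  proof -
    obtain a b where a: "a \<in> X" "(x = a \<and> a \<notin> A) \<or> (x = - a \<and> a \<in> A)"
      and b: "b \<in> X" "(y = b \<and> b \<notin> A) \<or> (y = - b \<and> b \<in> A)"
      using origin[OF xy(1)] origin[OF xy(2)] by blast
    have "a \<noteq> b" using a b xy(3) by auto
    then show ?thesis using XD(5)[OF a(1) b(1)] a b by auto
  qed
  moreover have "norm x = 1" if "x \<in> X'" for x
    using that A XD(4) by auto
  moreover have "finite X'" using A XD(3) finite_subset by auto
  ultimately show "equiangular \<alpha> X'" using XD(1,2) by (auto simp: equiangular_def)
qed

lemma normalized_rest_cases: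
  assumes "z \<in> normalized_rest \<alpha> X ps"
  obtains x where "x \<in> X" "x \<notin> set ps" "z = x \<or> z = - x"
  using assms by (auto simp: normalized_rest_def normalize_sign_def split: if_splits)

lemma inner_normalized_rest_base:
  assumes "equiangular \<alpha> X" "set ps \<subseteq> X" "z \<in> normalized_rest \<alpha> X ps" "p \<in> set ps"
  shows "inner z p = \<alpha> \<or> inner z p = - \<alpha>"
proof -
  obtain x where x: "x \<in> X" "x \<notin> set ps" "z = x \<or> z = - x"
    using normalized_rest_cases[OF assms(3)] .
  have "inner x p \<in> {-\<alpha>, \<alpha>}"
    using assms x by (metis equiangular_def subsetD)
  then show ?thesis using x(3) by auto
qed

definition one_positive :: "real \<Rightarrow> 'a::euclidean_space list \<Rightarrow> 'a \<Rightarrow> 'a \<Rightarrow> bool" where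
  "one_positive \<alpha> ps p z \<longleftrightarrow> inner z p = \<alpha> \<and> (\<forall>q\<in>set ps - {p}. inner z q = - \<alpha>)"

text \<open>
  A \<open>(K, 1)\<close> pillar is determined by the base vector at which its positive sign sits; in particular
  different pillars have different such base vectors.
\<close>
lemma is_pillar_1_cases:
  assumes X: "equiangular \<alpha> X" "\<alpha> > 0" and ps: "set ps \<subseteq> X" "distinct ps"
    and "is_pillar \<alpha> X ps 1 Q"
  obtains p where "p \<in> set ps" "Q = {z \<in> normalized_rest \<alpha> X ps. one_positive \<alpha> ps p z}"
proof -
  obtain x where x: "x \<in> normalized_rest \<alpha> X ps" "num_pos (sign_vec \<alpha> ps x) = 1"
      "Q = pillar \<alpha> X ps x"
    using assms(5) by (auto simp: is_pillar_def)
  have "card {i. i < length ps \<and> 0 < inner x (ps ! i) / \<alpha>} = 1"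
  proof -
    have "{i. i < length ps \<and> 0 < inner x (ps ! i) / \<alpha>}
        = {i. i < length (sign_vec \<alpha> ps x) \<and> 0 < sign_vec \<alpha> ps x ! i}"
      by (auto simp: sign_vec_def)
    then show ?thesis using x(2) by (simp add: num_pos_def length_filter_conv_card)
  qed
  then obtain j where j: "{i. i < length ps \<and> 0 < inner x (ps ! i) / \<alpha>} = {j}"
    by (rule card_1_singletonE)
  define p where "p = ps ! j"
  have jl: "j < length ps" "0 < inner x p / \<alpha>" using j by (auto simp: p_def)
  then have p: "p \<in> set ps" by (simp add: p_def)
  have xp: "inner x p = \<alpha>"
    using jl(2) inner_normalized_rest_base[OF X(1) ps(1) x(1) p] X(2) by auto
  have xq: "inner x q = - \<alpha>" if q: "q \<in> set ps - {p}" for q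
  proof -
    obtain i where i: "i < length ps" "q = ps ! i" using q by (auto simp: in_set_conv_nth)
    then have "i \<noteq> j" using q by (auto simp: p_def)
    then have "\<not> 0 < inner x q / \<alpha>" using i j by auto
    then show ?thesis
      using inner_normalized_rest_base[OF X(1) ps(1) x(1), of q] q X(2) by auto
  qed
  have xs: "inner x q = (if q = p then \<alpha> else - \<alpha>)" if "q \<in> set ps" for q
    using xp xq[of q] that by simp
  have "sign_vec \<alpha> ps z = sign_vec \<alpha> ps x \<longleftrightarrow> one_positive \<alpha> ps p z" for z
  proof -
    have "sign_vec \<alpha> ps z = sign_vec \<alpha> ps x \<longleftrightarrow> (\<forall>q\<in>set ps. inner z q = inner x q)"
      using X(2) by (auto simp: sign_vec_def)
    also have "\<dots> \<longleftrightarrow> one_positive \<alpha> ps p z"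
      using p by (auto simp: one_positive_def xs)
    finally show ?thesis .
  qed
  then show ?thesis using that[OF p] x(3) by (simp add: pillar_def)
qed

section \<open>Residuals of pillar vectors\<close>

text \<open>
  If \<open>x\<close> has inner product \<open>\<alpha>\<close> with \<open>p\<close> and \<open>-\<alpha>\<close> with the rest of the base \<open>P\<close>, where
  \<open>\<alpha> = 1/(2n+1)\<close> and \<open>card P = n + 2\<close>, this is the component of \<open>x\<close> orthogonal to the span of \<open>P\<close>:
  solving the linear system with the Gram matrix of \<open>P\<close> gives the projection the coefficient \<open>0\<close> at
  \<open>p\<close> and \<open>-1/(n+1)\<close> at every other base vector.
\<close>
definition residual :: "'a::euclidean_space set \<Rightarrow> 'a \<Rightarrow> 'a \<Rightarrow> 'a" where
  "residual P p x = x + (1 / (real (card P) - 1)) *\<^sub>R (\<Sum>q\<in>P - {p}. q)"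

lemma inner_sum_base:
  assumes "finite P" "p \<in> P" "p' \<in> P"
    and x: "inner x p = \<alpha>" "\<And>q. q \<in> P - {p} \<Longrightarrow> inner x q = - \<alpha>"
  shows "inner x (\<Sum>q\<in>P - {p'}. q)
    = - ((if p = p' then real (card P) - 1 else real (card P) - 3) * \<alpha>)"
proof -
  have P: "real (card P) = real (card (P - {p})) + 1"
    using card.remove[OF assms(1,2)] by simp
  have own: "(\<Sum>q\<in>P - {p}. inner x q) = - (real (card P) - 1) * \<alpha>"
    using x(2) P by (simp add: algebra_simps)
  have "(\<Sum>q\<in>P. inner x q) = \<alpha> + (\<Sum>q\<in>P - {p}. inner x q)"
    using sum.remove[OF assms(1,2), of "inner x"] x(1) by simp
  moreover have "(\<Sum>q\<in>P. inner x q) = inner x p' + (\<Sum>q\<in>P - {p'}. inner x q)"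
    using sum.remove[OF assms(1,3)] .
  ultimately show ?thesis
    using own x(2)[of p'] assms(3) by (auto simp: inner_sum_right algebra_simps)
qed

text \<open>
  Write the residuals as \<open>x + t\<close> and \<open>y + t'\<close> with \<open>-t\<close>, \<open>-t'\<close> in the span of \<open>P\<close>. As \<open>-t\<close> has the
  same inner products with \<open>P\<close> as \<open>x\<close>, and \<open>-t'\<close> the same as \<open>y\<close>, the three products
  \<open>\<langle>x, t'\<rangle>\<close>, \<open>\<langle>t, y\<rangle>\<close> and \<open>\<langle>-t, t'\<rangle>\<close> all equal the same number \<open>-e\<close>, and
  \<open>\<langle>x, y\<rangle> - e - e + e\<close> remains.
\<close>
lemma inner_residuals:
  fixes P :: "'a::euclidean_space set" and n :: nat
  assumes \<alpha>: "\<alpha> = 1 / (2 * real n + 1)" and P: "finite P" "card P = n + 2"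
    and clique: "\<And>p q. p \<in> P \<Longrightarrow> q \<in> P \<Longrightarrow> inner p q = (if p = q then 1 else - \<alpha>)"
    and p: "p \<in> P" "p' \<in> P"
    and x: "inner x p = \<alpha>" "\<And>q. q \<in> P - {p} \<Longrightarrow> inner x q = - \<alpha>"
    and y: "inner y p' = \<alpha>" "\<And>q. q \<in> P - {p'} \<Longrightarrow> inner y q = - \<alpha>"
  shows "inner (residual P p x) (residual P p' y)
    = inner x y - (if p = p' then \<alpha> else \<alpha> * (real n - 1) / (real n + 1))"
proof -
  define m where "m = real n + 1"
  have m: "m > 0" "real (card P) - 1 = m" "real (card P) - 3 = real n - 1"
    by (simp_all add: m_def P)
  define t where "t r = (1 / m) *\<^sub>R (\<Sum>q\<in>P - {r}. q)" for r
  define e where "e = (if p = p' then \<alpha> else \<alpha> * (real n - 1) / (real n + 1))"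
  have e: "(if p = p' then m else real n - 1) * \<alpha> = m * e"
    using m(1) by (simp add: e_def m_def)
  have "inner x (\<Sum>q\<in>P - {p'}. q) = - (m * e)"
    using inner_sum_base[OF P(1) p x] unfolding m(2,3) e .
  then have xt: "inner x (t p') = - e"
    using m(1) by (simp add: t_def)
  have "inner y (\<Sum>q\<in>P - {p}. q) = - (m * e)"
    using inner_sum_base[OF P(1) p(2,1) y] unfolding m(2,3) eq_commute[of p' p] e .
  then have yt: "inner (t p) y = - e"
    using m(1) by (simp add: t_def inner_commute[of _ y])
  have tr: "inner (t p) r = (if r = p then - \<alpha> else \<alpha>)" if "r \<in> P" for r
  proof -
    show ?thesis
    proof (cases "r = p")
      case True
      have "(\<Sum>q\<in>P - {p}. inner q r) = (\<Sum>q\<in>P - {p}. - \<alpha>)"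
        using clique that True by (intro sum.cong) auto
      also have "\<dots> = - m * \<alpha>" using P p by (simp add: m_def algebra_simps)
      finally show ?thesis using True m(1) by (simp add: t_def inner_sum_left)
    next
      case False
      have "(\<Sum>q\<in>P - {p}. inner q r) = 1 + (\<Sum>q\<in>P - {p} - {r}. inner q r)"
        using sum.remove[of "P - {p}" r "\<lambda>q. inner q r"] P(1) False that clique[OF that that]
        by simp
      also have "(\<Sum>q\<in>P - {p} - {r}. inner q r) = (\<Sum>q\<in>P - {p} - {r}. - \<alpha>)"
        using clique that by (intro sum.cong) auto
      also have "\<dots> = - real n * \<alpha>" using P p that False by simp
      \<comment> \<open>This is where the relation between \<open>\<alpha>\<close> and the size of the base makes \<open>-t p\<close> a projection.\<close>
      also have "1 + - real n * \<alpha> = m * \<alpha>"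
        by (simp add: m_def \<alpha> field_simps)
      finally show ?thesis using False m(1) by (simp add: t_def inner_sum_left)
    qed
  qed
  have tt: "inner (t p) (t p') = e"
  proof -
    have "inner (- t p) (\<Sum>q\<in>P - {p'}. q)
        = - ((if p = p' then real (card P) - 1 else real (card P) - 3) * \<alpha>)"
      by (rule inner_sum_base[OF P(1) p]) (use tr p in auto)
    also have "\<dots> = - (m * e)"
      unfolding m(2,3) e ..
    finally show ?thesis
      using m(1) unfolding t_def[of p'] by simp
  qed
  have "inner (residual P p x) (residual P p' y) = inner (x + t p) (y + t p')"
    unfolding residual_def t_def m(2) ..
  also have "\<dots> = inner x y - e"
    using xt yt tt by (simp add: inner_add_left inner_add_right)
  finally show ?thesis by (simp add: e_def)
qed

theorem theorem3p2:
  fixes n :: nat and \<alpha> :: real and X X' :: "'a::euclidean_space set"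
    and ps :: "'a list" and Q S :: "'a set"
  assumes "n \<ge> 2"
    and "\<alpha> = 1 / (2 * real n + 1)"
    and "equiangular \<alpha> X"
    and "base_size \<alpha> X = n + 2"
    and "K_base \<alpha> X ps"
    and "switching_equivalent X X'" and "set ps \<subseteq> X'"
    and "is_pillar \<alpha> X' ps 1 Q" and "card Q \<ge> 2"
    and "is_pillar \<alpha> X' ps 1 S" and "S \<noteq> Q"
  shows "(n \<le> 3 \<longrightarrow> real (card S) \<le> 2 * real n ^ 2 * (real n + 1)) \<and>
         (n \<ge> 3 \<longrightarrow> real (card S) \<le> 1 / 2 * real n ^ 2 * (real n + 1) ^ 2)"
proof -
  define P where "P = set ps"
  define R where "R = normalized_rest \<alpha> X' ps"
  have \<alpha>: "0 < \<alpha>" "\<alpha> < 1" using assms(1,2) by auto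
  have X': "equiangular \<alpha> X'" and X'X: "\<And>x. x \<in> X' \<Longrightarrow> x \<in> X \<or> - x \<in> X"
    using switching_equivalent_equiangular[OF assms(3,6)] by blast+
  have gram: "gram ps = base_mat \<alpha> (length ps)" and len: "length ps = n + 2"
    using assms(4,5) by (simp_all add: K_base_def)
  have dist: "distinct ps"
    and clique: "\<And>p q. p \<in> P \<Longrightarrow> q \<in> P \<Longrightarrow> inner p q = (if p = q then 1 else - \<alpha>)"
    using gram_base_mat_distinct[OF gram] \<alpha> by (auto simp: P_def)
  have P: "finite P" "card P = n + 2"
    using dist len by (simp_all add: P_def distinct_card)
  obtain p where p: "p \<in> P" and Q: "Q = {z \<in> R. one_positive \<alpha> ps p z}"
    using is_pillar_1_cases[OF X' \<alpha>(1) assms(7) dist assms(8)] unfolding P_def R_def .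
  obtain q where q: "q \<in> P" and S: "S = {z \<in> R. one_positive \<alpha> ps q z}"
    using is_pillar_1_cases[OF X' \<alpha>(1) assms(7) dist assms(10)] unfolding P_def R_def .
  have "p \<noteq> q" using Q S assms(11) by auto
  have RX: "z \<in> X \<or> - z \<in> X" and unit: "inner z z = 1" if z: "z \<in> R" for z
  proof -
    obtain x where x: "x \<in> X'" "z = x \<or> z = - x"
      using normalized_rest_cases z unfolding R_def by metis
    then show "z \<in> X \<or> - z \<in> X" using X'X by fastforce
    have "norm x = 1" using X' x(1) by (simp add: equiangular_def)
    then show "inner z z = 1" using x(2) by (auto simp: norm_eq_1)
  qed
  have RR: "inner y z = \<alpha> \<or> inner y z = - \<alpha>" if yz: "y \<in> R" "z \<in> R" "y \<noteq> z" "y \<noteq> - z" for y z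
  proof -
    obtain a where a: "a \<in> X'" "y = a \<or> y = - a"
      using normalized_rest_cases yz(1) unfolding R_def by metis
    obtain b where b: "b \<in> X'" "z = b \<or> z = - b"
      using normalized_rest_cases yz(2) unfolding R_def by metis
    have "a \<noteq> b" using a b yz by auto
    then have "inner a b \<in> {-\<alpha>, \<alpha>}" using X' a b by (auto simp: equiangular_def)
    then show ?thesis using a b by auto
  qed
  have "finite X'" using X' by (simp add: equiangular_def)
  then have "finite R" by (simp add: R_def normalized_rest_def)
  then have finS: "finite S" by (simp add: S)
  have pos: "inner z r = \<alpha>" "\<And>b. b \<in> P - {r} \<Longrightarrow> inner z b = - \<alpha>"
    if "one_positive \<alpha> ps r z" for z r
    using that by (auto simp: one_positive_def P_def)
  \<comment> \<open>Because \<open>K > 2\<close>, two \<open>(K, 1)\<close> sign patterns share a negative entry, so they are never opposite.\<close>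
  have not_opp: "y \<noteq> - z"
    if "one_positive \<alpha> ps r y" "one_positive \<alpha> ps r' z" "r \<in> P" "r' \<in> P" for y z r r'
  proof -
    have "card {r, r'} < card P" using P(2) assms(1) by (simp add: card_insert_if)
    then obtain b where "b \<in> P" "b \<noteq> r" "b \<noteq> r'"
      by (metis P(1) card_mono finite.emptyI finite_insert insertCI linorder_not_less subsetI)
    then have "inner y b = - \<alpha>" "inner z b = - \<alpha>" using pos that by auto
    then show ?thesis using \<alpha> by auto
  qed
  have same: "inner y z = \<alpha>"
    if yz: "y \<in> R" "z \<in> R" "one_positive \<alpha> ps r y" "one_positive \<alpha> ps r z" and "r \<in> P" "y \<noteq> z"
    for y z r
  proof (rule ccontr)
    assume "inner y z \<noteq> \<alpha>"
    then have neg: "inner y z = - \<alpha>" using RR[OF yz(1,2)] not_opp[OF yz(3,4)] that by auto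
    define W where "W = insert y (insert z (P - {r}))"
    have notP: "x \<notin> P - {r}" if "x \<in> R" "one_positive \<alpha> ps r x" for x
      using pos(2)[OF that(2), of x] unit[OF that(1)] \<alpha> by auto
    have "card (P - {r}) = n + 1" using P that(5) by simp
    then have "card W = n + 3"
      using notP yz that(6) P(1) by (simp add: W_def)
    moreover have "card W \<le> base_size \<alpha> X"
    proof (rule clique_card_le_base_size[OF assms(3)])
      show "finite W" by (simp add: W_def P)
      show "w \<in> X \<or> - w \<in> X" if "w \<in> W" for w
        using that RX yz X'X assms(7) by (auto simp: W_def P_def)
      show "inner w w' = - \<alpha>" if "w \<in> W" "w' \<in> W" "w \<noteq> w'" for w w'
        using that neg pos(2)[OF yz(3)] pos(2)[OF yz(4)] clique
        by (auto simp: W_def inner_commute)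
    qed
    ultimately show False using assms(4) by simp
  qed
  \<comment> \<open>The two values \<open>\<plusminus>\<alpha> - \<alpha>(n-1)/(n+1)\<close> across the pillars are \<open>d\<close> and \<open>-n d\<close>.\<close>
  define d where "d = 2 * \<alpha> / (real n + 1)"
  define c where "c = real n * (real n + 1) * d"
  have "c = 2 * real n * \<alpha>" by (simp add: c_def d_def)
  also have "\<dots> = 1 - \<alpha>" by (simp add: assms(2) field_simps)
  finally have c2: "c = 1 - \<alpha>" .
  have res: "inner (residual P r x) (residual P r' y)
      = inner x y - (if r = r' then \<alpha> else \<alpha> * (real n - 1) / (real n + 1))"
    if "r \<in> P" "r' \<in> P" "one_positive \<alpha> ps r x" "one_positive \<alpha> ps r' y" for r r' x y
    using that pos by (intro inner_residuals[OF assms(2) P clique]) auto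
  have orth: "inner (residual P r x) (residual P r y) = (if x = y then c else 0)"
    if "r \<in> P" "x \<in> R" "y \<in> R" "one_positive \<alpha> ps r x" "one_positive \<alpha> ps r y" for r x y
    using res[OF that(1,1,4,5)] same[OF that(2-5,1)] unit[OF that(2)] c2 by auto
  have cross: "inner (residual P p x) (residual P q y) \<in> {d, - real n * d}"
    if "x \<in> Q" "y \<in> S" for x y
  proof -
    have xy: "one_positive \<alpha> ps p x" "one_positive \<alpha> ps q y" "x \<in> R" "y \<in> R"
      using that Q S by auto
    have "x \<noteq> y"
    proof
      assume "x = y"
      then have "inner x p = \<alpha>" "inner x p = - \<alpha>"
        using pos(1)[OF xy(1)] pos(2)[OF xy(2)] p \<open>p \<noteq> q\<close> by auto
      then show False using \<alpha> by simp
    qed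
    then have "inner x y = \<alpha> \<or> inner x y = - \<alpha>"
      using RR xy not_opp p q by blast
    then show ?thesis
      using res[OF p q xy(1,2)] \<open>p \<noteq> q\<close> by (auto simp: d_def field_simps)
  qed
  obtain u v where uv: "u \<in> Q" "v \<in> Q" "u \<noteq> v"
    using assms(9) by (metis card_2_iff' card_le_Suc0_iff_eq card.infinite numeral_2_eq_2 not_less_eq_eq not_numeral_le_zero)
  show ?thesis
  proof (intro conjI impI)
    note * = orthogonal_system_card_bound[OF finS, where n = n and d = d and c = c
        and f = "residual P q" and u = "residual P p u" and v = "residual P p v"]
    have h: "1 \<le> n" "0 < d" using assms(1) \<alpha> by (auto simp: d_def)
    have o: "inner (residual P p u) (residual P p u) = c"
        "inner (residual P p v) (residual P p v) = c"
        "inner (residual P p u) (residual P p v) = 0"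
      using uv Q p by (auto simp: orth)
    have oS: "inner (residual P q x) (residual P q y) = (if x = y then c else 0)"
      if "x \<in> S" "y \<in> S" for x y
      using that S q orth by auto
    show "real (card S) \<le> 2 * real n ^ 2 * (real n + 1)" if "n \<le> 3"
      by (rule *(1)[OF h c_def oS o cross cross that]) (use uv in auto)
    show "real (card S) \<le> 1 / 2 * real n ^ 2 * (real n + 1) ^ 2" if "n \<ge> 3"
      by (rule *(2)[OF h c_def oS o cross cross that]) (use uv in auto)
  qed
qed

end
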